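(* For every real number $x>0$, $$F(x)=\lim_{n\to\infty}\frac{P_n(x)}{Q_n(x)},$$ and for every integer $n\ge 1$ and every real $x>0$, $$\left|F(x)-\frac{P_n(x)}{Q_n(x)}\right|<\begin{cases}\dfrac{1}{Q_n(x)Q_{n-1}(x)} & \text{if } n \text{ is even},\\[3mm] \dfrac{1}{\frac{2}{n+1}Q_n(x)^2+Q_n(x)Q_{n-1}(x)} & \text{if } n\text{ is odd}.\end{cases}$$
   Context: For real $x>0$ put $F(x)=e^{x}\int_x^\infty \frac{e^{-t}}{t}\,dt=\int_0^\infty \frac{e^{-t}}{t+x}\,dt$. For an integer $m\ge1$ let $c_m=c_m(x)$ be $x$ if $m$ is odd and $\frac{2}{m}$ if $m$ is even. The polynomials $P_n(x),Q_n(x)$ are defined by $P_{-1}(x)=1$, $Q_{-1}(x)=0$, $P_0(x)=0$, $Q_0(x)=1$, and, for $n\ge1$, $P_n(x)=c_nP_{n-1}(x)+P_{n-2}(x)$, $Q_n(x)=c_nQ_{n-1}(x)+Q_{n-2}(x)$. Thus $P_n(x)/Q_n(x)$ is the finite continued fraction $\cfrac{1}{c_1+\cfrac{1}{c_2+\cdots+\cfrac{1}{c_n}}}$. *)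

theory Defs
  imports "HOL-Analysis.Analysis"
begin

definition F :: "real \<Rightarrow> real" where
  "F x = exp x * (LBINT t:{x..}. exp (- t) / t)"

definition c :: "nat \<Rightarrow> real poly" where
  "c m = (if odd m then [:0, 1:] else [:2 / of_nat m:])"

(* The index starts at -1 in the mathematics: a is the value at -1, b the value at 0. *)
fun cf_rec :: "real poly \<Rightarrow> real poly \<Rightarrow> nat \<Rightarrow> real poly" where
  "cf_rec a b 0 = b"
| "cf_rec a b (Suc 0) = c 1 * b + a"
| "cf_rec a b (Suc (Suc n)) = c (Suc (Suc n)) * cf_rec a b (Suc n) + cf_rec a b n"

definition P :: "nat \<Rightarrow> real poly" where
  "P = cf_rec 1 0"

definition Q :: "nat \<Rightarrow> real poly" where
  "Q = cf_rec 0 1"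

(* The Lebesgue integral of a non-integrable function is 0 by convention; for x > 0
   the integrand of F is integrable. *)
lemma F_integrable:
  assumes "x > 0"
  shows "set_integrable lborel {x..} (\<lambda>t::real. exp (- t) / t)"
proof -
  have "set_integrable lebesgue {x..} (\<lambda>t::real. exp (-1 * t))"
    using integrable_on_exp_minus_to_infinity[of 1 x]
    by (intro nonnegative_absolutely_integrable_1) auto
  then have e: "set_integrable lborel {x..} (\<lambda>t::real. exp (- t))"
    unfolding set_integrable_def
    by (subst (asm) integrable_completion) (auto intro!: borel_measurable_scaleR)
  show ?thesis
  proof (rule set_integrable_bound)
    show "set_integrable lborel {x..} (\<lambda>t::real. (1 / x) *\<^sub>R exp (- t))"
      using e by (intro set_integrable_scaleR_right) auto
    show "set_borel_measurable lborel {x..} (\<lambda>t::real. exp (- t) / t)"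
      unfolding set_borel_measurable_def by measurable
    show "AE t in lborel. t \<in> {x..} \<longrightarrow>
        norm (exp (- t) / t) \<le> norm ((1 / x) *\<^sub>R exp (- t))"
      using assms by (auto simp: field_simps)
  qed
qed

lemma F_alt: "F x = (LBINT t:{0..}. exp (- t) / (t + x))"
proof -
  have "(LBINT t:{x..}. exp (- t) / t)
      = (LBINT s. indicator {x..} (x + s) *\<^sub>R (exp (- (x + s)) / (x + s)))"
    unfolding set_lebesgue_integral_def
    by (subst lborel_integral_real_affine[where c = 1 and t = x]) auto
  also have "\<dots> = (LBINT s. exp (- x) * (indicator {0..} s *\<^sub>R (exp (- s) / (s + x))))"
    by (intro Bochner_Integration.integral_cong)
       (auto simp: indicator_def exp_add exp_diff exp_minus field_simps)
  also have "\<dots> = exp (- x) * (LBINT s:{0..}. exp (- s) / (s + x))"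
    unfolding set_lebesgue_integral_def by (rule integral_mult_right_zero)
  finally show ?thesis
    unfolding F_def by (simp add: exp_minus)
qed

end

theory Submission
  imports Defs
begin

text \<open>Up to sign, the remainders \<open>F Q\<^sub>n - P\<^sub>n\<close> are the positive integrals
  of \<open>exp (-t) t^k / (t + x)^m\<close> with \<open>m = k + 1\<close> for \<open>n = 2k\<close>
  and \<open>m = k\<close> for \<open>n = 2k - 1\<close>: splitting \<open>t + x\<close> and integrating
  by parts give exactly the three-term recurrence, with alternating signs.
  Writing \<open>s\<^sub>n\<close> for these integrals, \<open>s\<^sub>n\<^sub>-\<^sub>1 Q\<^sub>n + s\<^sub>n Q\<^sub>n\<^sub>-\<^sub>1 = 1\<close> follows,
  which yields both bounds; they tend to zero since \<open>Q\<close> is at least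
  \<open>1\<close> at even indices and grows linearly at odd ones.\<close>

section \<open>Moment integrals and the relations between them\<close>

definition moment :: "real \<Rightarrow> nat \<Rightarrow> nat \<Rightarrow> real" where
  "moment x k m = (LBINT t:{0..}. exp (- t) * (t ^ k / (t + x) ^ m))"

definition remainder :: "real \<Rightarrow> nat \<Rightarrow> real" where
  "remainder x n = moment x (Suc n div 2) (Suc (n div 2))"

lemma set_integrable_exp_minus: "set_integrable lborel {0..} (\<lambda>t::real. exp (- t))"
proof -
  have "set_integrable lebesgue {0..} (\<lambda>t::real. exp (-1 * t))"
    using integrable_on_exp_minus_to_infinity[of 1 0]
    by (intro nonnegative_absolutely_integrable_1) auto
  then show ?thesis
    unfolding set_integrable_def
    by (subst (asm) integrable_completion) (auto intro!: borel_measurable_scaleR)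
qed

text \<open>For \<open>t \<ge> 0\<close> both \<open>t\<close> and \<open>x\<close> are at most
  \<open>t + x\<close>, so the rational factor is bounded by the constant
  \<open>1 / x ^ (m - k)\<close> and \<open>exp (- t)\<close> dominates.\<close>

lemma moment_integrable:
  fixes x :: real
  assumes "x > 0" "k \<le> m"
  shows "set_integrable lborel {0..} (\<lambda>t. exp (- t) * (t ^ k / (t + x) ^ m))"
proof (rule set_integrable_bound)
  show "set_integrable lborel {0..} (\<lambda>t::real. (1 / x ^ (m - k)) *\<^sub>R exp (- t))"
    using set_integrable_exp_minus by (intro set_integrable_scaleR_right) auto
  show "set_borel_measurable lborel {0..} (\<lambda>t::real. exp (- t) * (t ^ k / (t + x) ^ m))"
    unfolding set_borel_measurable_def by measurable
  have "t ^ k / (t + x) ^ m \<le> 1 / x ^ (m - k)" if "t \<ge> 0" for t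
  proof -
    have "t ^ k * x ^ (m - k) \<le> (t + x) ^ k * (t + x) ^ (m - k)"
      using assms that by (intro mult_mono power_mono) auto
    also have "\<dots> = (t + x) ^ m"
      using assms by (simp flip: power_add)
    finally show ?thesis
      using assms that by (simp add: divide_simps)
  qed
  then have "exp (- t) * (t ^ k / (t + x) ^ m) \<le> exp (- t) * (1 / x ^ (m - k))" if "t \<ge> 0" for t
    using that by (intro mult_left_mono) auto
  then show "AE t in lborel. t \<in> {0..} \<longrightarrow>
      norm (exp (- t) * (t ^ k / (t + x) ^ m)) \<le> norm ((1 / x ^ (m - k)) *\<^sub>R exp (- t))"
    using assms by (intro AE_I2) (simp add: abs_mult mult.commute)
qed

lemma moment_pos:
  assumes "x > 0" "k \<le> m"
  shows "moment x k m > 0"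
proof -
  let ?f = "\<lambda>t. indicator {0..} t *\<^sub>R (exp (- t) * (t ^ k / (t + x) ^ m))"
  have int: "integrable lborel ?f"
    using moment_integrable[OF assms] by (simp add: set_integrable_def)
  have nonneg: "?f t \<ge> 0" for t
    using assms by (simp add: indicator_def)
  have "(LBINT t. ?f t) \<noteq> 0"
  proof
    assume "(LBINT t. ?f t) = 0"
    then have "AE t in lborel. ?f t = 0"
      using integral_nonneg_eq_0_iff_AE[OF int] nonneg by simp
    \<comment> \<open>Any interval of positive length inside the open half-line would do: there the
      integrand is strictly positive, whereas at 0 the factor \<open>t ^ k\<close> may
      vanish.\<close>
    then have "AE t in lborel. t \<notin> {1..2::real}"
      by (rule eventually_mono) (use assms in \<open>auto simp: indicator_def\<close>)
    then have "{1..2::real} \<in> null_sets lborel"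
      by (subst AE_iff_null_sets) auto
    then show False
      by (simp add: null_sets_def)
  qed
  moreover have "(LBINT t. ?f t) \<ge> 0"
    using nonneg by (rule Bochner_Integration.integral_nonneg)
  ultimately have "(LBINT t. ?f t) > 0"
    by linarith
  then show ?thesis
    by (simp add: moment_def set_lebesgue_integral_def)
qed

text \<open>Multiply the integrand by \<open>(t + x) / (t + x)\<close> and expand the
  numerator.\<close>

lemma moment_split:
  assumes "x > 0" "k \<le> m"
  shows "moment x k m = moment x (Suc k) (Suc m) + x * moment x k (Suc m)"
proof -
  have "moment x k m = (LBINT t:{0..}. exp (- t) * (t ^ Suc k / (t + x) ^ Suc m)
      + x * (exp (- t) * (t ^ k / (t + x) ^ Suc m)))"
    unfolding moment_def
  proof (rule set_lebesgue_integral_cong; (intro allI impI)?)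
    fix t :: real assume "t \<in> {0..}"
    then have "t + x \<noteq> 0"
      using assms by auto
    then show "exp (- t) * (t ^ k / (t + x) ^ m) = exp (- t) * (t ^ Suc k / (t + x) ^ Suc m)
      + x * (exp (- t) * (t ^ k / (t + x) ^ Suc m))"
      by (simp add: divide_simps) (simp add: algebra_simps)
  qed auto
  also have "\<dots> = moment x (Suc k) (Suc m) + x * moment x k (Suc m)"
    unfolding moment_def using assms
    by (subst set_integral_add(2))
       (auto intro!: moment_integrable set_integrable_mult_right simp del: power_Suc times_divide_eq_right)
  finally show ?thesis .
qed

text \<open>Integration by parts of \<open>exp (- t)\<close> against
  \<open>(t / (t + x)) ^ Suc k\<close>, where \<open>t / (t + x)\<close> has derivative
  \<open>x / (t + x)^2\<close>. It is carried out by exhibiting an antiderivative \<open>?G\<close>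
  of the difference \<open>?g\<close> of the two integrands and showing that \<open>?G\<close>
  vanishes at both ends.\<close>

lemma moment_by_parts:
  assumes x: "x > 0"
  shows "moment x (Suc k) (Suc k) = real (Suc k) * x * moment x k (Suc (Suc k))"
proof -
  let ?G = "\<lambda>t. - (exp (- t) * (t / (t + x)) ^ Suc k)"
  let ?g = "\<lambda>t. exp (- t) * (t ^ Suc k / (t + x) ^ Suc k)
    - real (Suc k) * x * (exp (- t) * (t ^ k / (t + x) ^ Suc (Suc k)))"
  have int: "set_integrable lborel {0..} ?g"
    using x by (intro set_integral_diff set_integrable_mult_right moment_integrable) auto
  have lim1: "((\<lambda>b. LBINT t:{0..b}. ?g t) \<longlongrightarrow> (LBINT t:{0..}. ?g t)) at_top"
    by (rule tendsto_set_lebesgue_integral_at_top[OF _ int]) auto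
  have der: "(?G has_real_derivative ?g t) (at t)" if "t \<ge> 0" for t
  proof -
    have nz: "t + x \<noteq> 0" using that x by auto
    then have "((\<lambda>t. t / (t + x)) has_real_derivative x / (t + x)\<^sup>2) (at t)"
      by (auto intro!: derivative_eq_intros simp: power2_eq_square)
    from DERIV_power[OF this, of "Suc k"]
    have "((\<lambda>t. (t / (t + x)) ^ Suc k) has_real_derivative
        real (Suc k) * x * (t ^ k / (t + x) ^ Suc (Suc k))) (at t)"
      by (rule DERIV_cong) (use nz in \<open>simp add: power_divide power2_eq_square field_simps\<close>)
    moreover have "((\<lambda>t. exp (- t)) has_real_derivative - exp (- t)) (at t)"
      by (auto intro!: derivative_eq_intros)
    ultimately show ?thesis
      by (intro DERIV_cong[OF DERIV_minus[OF DERIV_mult]])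
         (auto simp: power_divide algebra_simps simp del: power_Suc of_nat_Suc)
  qed
  \<comment> \<open>\<open>?G 0 = 0\<close> because the exponent \<open>Suc k\<close> is positive,
    so only the upper boundary term remains.\<close>
  have FTC: "(LBINT t:{0..b}. ?g t) = ?G b" if "b \<ge> 0" for b
  proof -
    have "(LBINT t. ?g t * indicator {0..b} t) = ?G b - ?G 0"
      using that x by (intro integral_FTC_Icc_real der)
        (auto intro!: continuous_intros)
    then show ?thesis
      by (simp add: set_lebesgue_integral_def mult.commute)
  qed
  have "((\<lambda>b. ?G b) \<longlongrightarrow> 0) at_top"
  proof (rule Lim_null_comparison)
    show "\<forall>\<^sub>F b in at_top. norm (?G b) \<le> exp (- b)"
      using eventually_ge_at_top[of 0]
    proof eventually_elim
      case (elim b)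
      have "(b / (b + x)) ^ Suc k \<le> 1"
        using elim x by (intro power_le_one) auto
      then show ?case
        using elim x by (simp add: abs_mult mult_left_le del: power_Suc)
    qed
    show "((\<lambda>b::real. exp (- b)) \<longlongrightarrow> 0) at_top"
      by (rule filterlim_compose[OF exp_at_bot filterlim_uminus_at_bot_at_top])
  qed
  then have "((\<lambda>b. LBINT t:{0..b}. ?g t) \<longlongrightarrow> 0) at_top"
    by (rule Lim_transform_eventually)
       (rule eventually_mono[OF eventually_ge_at_top[of 0] FTC[symmetric]])
  then have "(LBINT t:{0..}. ?g t) = 0"
    using lim1 tendsto_unique[OF trivial_limit_at_top_linorder] by blast
  moreover have "(LBINT t:{0..}. ?g t)
      = moment x (Suc k) (Suc k) - real (Suc k) * x * moment x k (Suc (Suc k))"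
    unfolding moment_def using x
    by (subst set_integral_diff(2))
       (auto intro!: moment_integrable set_integrable_mult_right simp del: of_nat_Suc power_Suc times_divide_eq_right)
  ultimately show ?thesis by simp
qed

section \<open>Remainders, their recurrence and their link to the convergents\<close>

lemma remainder_pos: "x > 0 \<Longrightarrow> remainder x n > 0"
  unfolding remainder_def by (rule moment_pos) auto

lemma remainder_0: "remainder x 0 = F x"
  by (simp add: remainder_def moment_def F_alt)

text \<open>Splitting the total mass \<open>moment x 0 0 = 1\<close> of \<open>exp (- t)\<close>
  produces both \<open>remainder x 1\<close> and \<open>x * F x\<close>.\<close>

lemma remainder_1:
  assumes "x > 0"
  shows "remainder x 1 = 1 - x * F x"
proof -
  have "moment x 0 0 = (LBINT t:{0..}. exp (- t))"
    by (simp add: moment_def)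
  also have "\<dots> = 1"
    using set_borel_integral_eq_integral(2)[OF set_integrable_exp_minus]
      has_integral_exp_minus_to_infinity[of 1 0] by (simp add: integral_unique)
  finally show ?thesis
    using moment_split[OF assms, of 0 0]
    by (simp add: remainder_def flip: remainder_0)
qed

lemma remainder_rec:
  assumes x: "x > 0"
  shows "remainder x n = poly (c (Suc (Suc n))) x * remainder x (Suc n) + remainder x (Suc (Suc n))"
proof (cases "even n")
  case True
  then obtain k where n: "n = 2 * k" by blast
  show ?thesis
    \<comment> \<open>The split leaves the term \<open>x * moment x k (k + 2)\<close>, which is no
      remainder; by parts it equals \<open>moment x (k + 1) (k + 1) / (k + 1)\<close>, and
      \<open>1 / (k + 1) = 2 / (n + 2)\<close> is the even-index coefficient.\<close>
    using moment_split[OF x, of k "Suc k"] moment_by_parts[OF x, of k]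
    by (simp add: n remainder_def c_def field_simps)
next
  case False
  then obtain k where n: "n = 2 * k + 1" using oddE by blast
  show ?thesis
    \<comment> \<open>Here all three moments are already remainders, and the factor \<open>x\<close>
      is the odd-index coefficient.\<close>
    using moment_split[OF x, of "Suc k" "Suc k"]
    by (simp add: n remainder_def c_def)
qed

lemma Q_rec: "poly (Q (Suc (Suc n))) x = poly (c (Suc (Suc n))) x * poly (Q (Suc n)) x + poly (Q n) x"
  by (simp add: Q_def)

lemma P_rec: "poly (P (Suc (Suc n))) x = poly (c (Suc (Suc n))) x * poly (P (Suc n)) x + poly (P n) x"
  by (simp add: P_def)

lemma initial_values:
  "poly (Q 0) x = 1" "poly (Q (Suc 0)) x = x" "poly (P 0) x = 0" "poly (P (Suc 0)) x = 1"
  by (simp_all add: Q_def P_def c_def)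

text \<open>The left side satisfies \<open>y (n+2) = c * y (n+1) + y n\<close>, the remainders
  satisfy \<open>s (n+2) = s n - c * s (n+1)\<close>; the factor \<open>(-1) ^ n\<close> turns one
  recurrence into the other.\<close>

lemma remainder_eq:
  assumes x: "x > 0"
  shows "F x * poly (Q n) x - poly (P n) x = (-1) ^ n * remainder x n"
proof (induction n rule: induct_nat_012)
  case (ge2 n)
  have "F x * poly (Q (Suc (Suc n))) x - poly (P (Suc (Suc n))) x
      = poly (c (Suc (Suc n))) x * (F x * poly (Q (Suc n)) x - poly (P (Suc n)) x)
        + (F x * poly (Q n) x - poly (P n) x)"
    by (simp add: Q_rec P_rec algebra_simps)
  then show ?case
    unfolding ge2 using remainder_rec[OF x, of n] by (simp add: algebra_simps)
qed (use remainder_1[OF x] in \<open>auto simp: initial_values remainder_0\<close>)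

section \<open>Growth of the denominators\<close>

text \<open>Induction over pairs of indices: passing to the next even index adds a nonnegative term,
  and passing to the next odd index adds \<open>x\<close> times an even-index value, hence at least
  \<open>x\<close>.\<close>

lemma Q_lower_bounds:
  assumes x: "x > 0"
  shows "poly (Q (2 * k)) x \<ge> 1 \<and> poly (Q (Suc (2 * k))) x \<ge> real (Suc k) * x"
proof (induction k)
  case (Suc k)
  have "poly (c (Suc (Suc (2 * k)))) x * poly (Q (Suc (2 * k))) x \<ge> 0"
    using Suc x by (intro mult_nonneg_nonneg) (auto simp: c_def intro: order_trans[rotated])
  then have even: "poly (Q (Suc (Suc (2 * k)))) x \<ge> 1"
    using Suc by (simp add: Q_rec)
  then have "x * poly (Q (Suc (Suc (2 * k)))) x \<ge> x"
    using x by simp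
  then have "poly (Q (Suc (Suc (Suc (2 * k))))) x \<ge> x + real (Suc k) * x"
    using Suc Q_rec[of "Suc (2 * k)" x] by (simp add: c_def)
  with even show ?case
    by (simp add: algebra_simps)
qed (simp add: initial_values)

lemma Q_pos:
  assumes "x > 0"
  shows "poly (Q n) x > 0"
proof (cases "even n")
  case True
  then show ?thesis
    using Q_lower_bounds[OF assms] by (metis evenE less_le_trans zero_less_one)
next
  case False
  then obtain k where "n = Suc (2 * k)" by (metis oddE Suc_eq_plus1)
  moreover have "real (Suc k) * x > 0" using assms by simp
  ultimately show ?thesis
    using Q_lower_bounds[OF assms, of k] by auto
qed

text \<open>Two consecutive indices contain one of each parity, so one factor is at least 1 and the
  other grows linearly. The constant \<open>x / 2\<close> serves both parities, since the linear
  bound gains \<open>x\<close> only every second index.\<close>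

lemma Q_product_lower_bound:
  assumes x: "x > 0"
  shows "poly (Q (Suc n)) x * poly (Q n) x \<ge> x / 2 * real (Suc n)"
proof (cases "even n")
  case True
  then obtain k where n: "n = 2 * k" by blast
  have "x / 2 * real (Suc n) \<le> real (Suc k) * x * 1"
    using x by (simp add: n field_simps)
  also have "\<dots> \<le> poly (Q (Suc n)) x * poly (Q n) x"
    unfolding n using Q_lower_bounds[OF x, of k] x Q_pos[OF x] by (intro mult_mono) (auto simp: less_imp_le)
  finally show ?thesis .
next
  case False
  then obtain k where n: "n = Suc (2 * k)" by (metis oddE Suc_eq_plus1)
  have "x / 2 * real (Suc n) = 1 * (real (Suc k) * x)"
    by (simp add: n field_simps)
  also have "\<dots> \<le> poly (Q (2 * Suc k)) x * poly (Q n) x"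
    unfolding n using Q_lower_bounds[OF x, of k] Q_lower_bounds[OF x, of "Suc k"] x Q_pos[OF x]
    by (intro mult_mono) (auto simp: less_imp_le)
  finally show ?thesis
    by (simp add: n)
qed

section \<open>Error bounds and convergence\<close>

text \<open>The expression does not depend on \<open>n\<close>: expanding \<open>Q (n+2)\<close> in
  the next instance and collecting the multiples of \<open>Q (n+1)\<close> reassembles
  \<open>remainder x n\<close>.\<close>

lemma remainder_Q_identity:
  assumes x: "x > 0"
  shows "remainder x n * poly (Q (Suc n)) x + remainder x (Suc n) * poly (Q n) x = 1"
proof (induction n)
  case 0
  then show ?case
    using remainder_1[OF x] by (simp add: initial_values remainder_0)
next
  case (Suc n)
  then show ?case
    by (simp add: Q_rec remainder_rec[OF x, of n] algebra_simps)
qed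

lemma error_eq:
  assumes "x > 0"
  shows "\<bar>F x - poly (P n) x / poly (Q n) x\<bar> = remainder x n / poly (Q n) x"
proof -
  have "F x - poly (P n) x / poly (Q n) x = (F x * poly (Q n) x - poly (P n) x) / poly (Q n) x"
    using Q_pos[OF assms, of n] by (simp add: field_simps)
  then show ?thesis
    using remainder_eq[OF assms, of n] remainder_pos[OF assms, of n] Q_pos[OF assms, of n]
    by (simp add: abs_mult)
qed

text \<open>Drop the positive term \<open>remainder x n * Q (n+1)\<close> from the identity.\<close>

lemma error_less:
  assumes x: "x > 0"
  shows "\<bar>F x - poly (P (Suc n)) x / poly (Q (Suc n)) x\<bar>
    < 1 / (poly (Q (Suc n)) x * poly (Q n) x)"
proof -
  have "remainder x (Suc n) * poly (Q n) x < 1"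
    using remainder_Q_identity[OF x, of n] mult_pos_pos[OF remainder_pos[OF x, of n] Q_pos[OF x, of "Suc n"]]
    by linarith
  then show ?thesis
    unfolding error_eq[OF x] using Q_pos[OF x] by (simp add: divide_simps)
qed

text \<open>The same argument with the identity one index later, where the remainder at
  \<open>n + 1\<close> is multiplied by \<open>Q (n+2)\<close>; this is \<open>?d\<close> once
  expanded by the recurrence.\<close>

lemma error_less_sharp:
  assumes x: "x > 0"
  shows "\<bar>F x - poly (P (Suc n)) x / poly (Q (Suc n)) x\<bar>
    < 1 / (poly (c (Suc (Suc n))) x * (poly (Q (Suc n)) x)\<^sup>2 + poly (Q (Suc n)) x * poly (Q n) x)"
proof -
  let ?q = "poly (Q (Suc n)) x" and ?d = "poly (c (Suc (Suc n))) x * poly (Q (Suc n)) x + poly (Q n) x"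
  have d: "?d > 0"
    using Q_pos[OF x, of "Suc (Suc n)"] by (simp add: Q_rec)
  have "remainder x (Suc n) * ?d + remainder x (Suc (Suc n)) * ?q = 1"
    using remainder_Q_identity[OF x, of "Suc n"] by (simp add: Q_rec)
  then have "remainder x (Suc n) * ?d < 1"
    using mult_pos_pos[OF remainder_pos[OF x, of "Suc (Suc n)"] Q_pos[OF x, of "Suc n"]] by linarith
  then have "remainder x (Suc n) / ?q < 1 / (?q * ?d)"
    using d Q_pos[OF x, of "Suc n"] by (simp add: divide_simps)
  then show ?thesis
    unfolding error_eq[OF x] by (simp add: algebra_simps power2_eq_square)
qed

lemma convergents_tendsto:
  assumes x: "x > 0"
  shows "(\<lambda>n. poly (P n) x / poly (Q n) x) \<longlonglongrightarrow> F x"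
proof -
  \<comment> \<open>The sequence is shifted by one because the error bound at \<open>Suc n\<close>
    involves \<open>Q n\<close>.\<close>
  have "(\<lambda>n. poly (P (Suc n)) x / poly (Q (Suc n)) x - F x) \<longlonglongrightarrow> 0"
  proof (rule Lim_null_comparison)
    show "\<forall>\<^sub>F n in sequentially. norm (poly (P (Suc n)) x / poly (Q (Suc n)) x - F x)
        \<le> 2 / x * inverse (real (Suc n))"
    proof (rule always_eventually, rule allI)
      fix n
      have "norm (poly (P (Suc n)) x / poly (Q (Suc n)) x - F x)
          \<le> 1 / (poly (Q (Suc n)) x * poly (Q n) x)"
        using error_less[OF x, of n] by (simp add: abs_minus_commute)
      also have "\<dots> \<le> 1 / (x / 2 * real (Suc n))"
        using Q_product_lower_bound[OF x, of n] x by (intro divide_left_mono mult_pos_pos Q_pos) auto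
      also have "\<dots> = 2 / x * inverse (real (Suc n))"
        by (simp add: field_simps)
      finally show "norm (poly (P (Suc n)) x / poly (Q (Suc n)) x - F x)
          \<le> 2 / x * inverse (real (Suc n))" .
    qed
    show "(\<lambda>n. 2 / x * inverse (real (Suc n))) \<longlonglongrightarrow> 0"
      by (rule tendsto_mult_right_zero[OF LIMSEQ_inverse_real_of_nat])
  qed
  then show ?thesis
    by (simp add: LIM_zero_iff filterlim_sequentially_Suc[of "\<lambda>n. poly (P n) x / poly (Q n) x"])
qed

theorem mainTheorem1:
  fixes x :: real
  assumes "x > 0"
  shows "((\<lambda>n. poly (P n) x / poly (Q n) x) \<longlonglongrightarrow> F x) \<and>
    (\<forall>n\<ge>1. \<bar>F x - poly (P n) x / poly (Q n) x\<bar> <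
      (if even n then 1 / (poly (Q n) x * poly (Q (n - 1)) x)
       else 1 / (2 / (real n + 1) * (poly (Q n) x)\<^sup>2 + poly (Q n) x * poly (Q (n - 1)) x)))"
proof (intro conjI allI impI)
  fix n :: nat assume "n \<ge> 1"
  then obtain m where n: "n = Suc m"
    by (cases n) auto
  show "\<bar>F x - poly (P n) x / poly (Q n) x\<bar> <
      (if even n then 1 / (poly (Q n) x * poly (Q (n - 1)) x)
       else 1 / (2 / (real n + 1) * (poly (Q n) x)\<^sup>2 + poly (Q n) x * poly (Q (n - 1)) x))"
  proof (cases "even n")
    case True
    then show ?thesis
      using error_less[OF assms, of m] by (simp add: n)
  next
    case False
    \<comment> \<open>For odd \<open>n\<close> the next index \<open>n + 1\<close> is even, so the
      sharper bound carries the constant coefficient.\<close>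
    then have "poly (c (Suc (Suc m))) x = 2 / (real n + 1)"
      by (simp add: n c_def add_ac)
    then show ?thesis
      using error_less_sharp[OF assms, of m] False by (simp add: n)
  qed
qed (rule convergents_tendsto[OF assms])

end
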